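(* Let $S$ be a left cancellative left reversible semigroup and let $H$ be a group. Then every homomorphism $\phi:S\to H$ gives rise to a unique homomorphism $\phi':G(S)\to H$ such that $\phi'\circ\gamma_S=\phi$. Moreover, for any left cancellative left reversible semigroup $R$ and homomorphism $\phi:S\to R$, there is a unique homomorphism $\phi':G(S)\to G(R)$ such that $\phi'\circ\gamma_S=\gamma_R\circ\phi$.
   Context: A semigroup means a set with associative product and identity element $1$; homomorphisms preserve identities. $S$ is left cancellative if $sr=st$ implies $r=t$, and left reversible if $sS\cap tS\ne\varnothing$ for all $s,t\in S$. For $s\in S$ let $\lambda_s:S\to sS$, $\lambda_s(t)=st$. $I(S)$ is the inverse semigroup of all partially defined bijections of $S$ (product $fg$ is composition on $g^{-1}(\mathrm{dom} f)$; $f^*$ is the inverse map). $I_l(S)$ is the inverse subsemigroup of $I(S)$ generated by $\{\lambda_s\}_{s\in S}$; when $S$ is left reversible it does not contain the empty map. On $I_l(S)$ define $p\sim q$ iff $pr=qr$ for some $r\in I_l(S)$. This is a congruence and $G(S):=I_l(S)/\!\sim$ is a group (the maximal group homomorphic image of $I_l(S)$), with quotient homomorphism $\alpha_S:I_l(S)\to G(S)$. Define $\gamma_S:S\to G(S)$ by $\gamma_S(s)=\alpha_S(\lambda_s)$. *)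

theory Defs
  imports "HOL-Algebra.Coset" "HOL-Library.FuncSet"
begin

section \<open>Left cancellative, left reversible monoids\<close>

text \<open>The identity is part of the structure, so homomorphisms must preserve it; \<^const>\<open>hom\<close> alone
  only asks for multiplicativity.\<close>

definition monoid_hom :: "('a, 'm) monoid_scheme \<Rightarrow> ('b, 'n) monoid_scheme \<Rightarrow> ('a \<Rightarrow> 'b) set" where
  "monoid_hom A B = {f \<in> hom A B. f \<one>\<^bsub>A\<^esub> = \<one>\<^bsub>B\<^esub>}"

locale lc_lr_monoid = monoid S for S (structure) +
  assumes left_cancel:
    "\<lbrakk>s \<in> carrier S; r \<in> carrier S; t \<in> carrier S; s \<otimes> r = s \<otimes> t\<rbrakk> \<Longrightarrow> r = t"
  and left_reversible:
    "\<lbrakk>s \<in> carrier S; t \<in> carrier S\<rbrakk> \<Longrightarrow> (s <# carrier S) \<inter> (t <# carrier S) \<noteq> {}"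


section \<open>Partial bijections and the left inverse hull\<close>

definition partial_bij :: "'a set \<Rightarrow> ('a \<rightharpoonup> 'a) monoid" where
  "partial_bij A =
     \<lparr>carrier = {f. dom f \<subseteq> A \<and> ran f \<subseteq> A \<and> inj_on f (dom f)},
      mult = (\<circ>\<^sub>m), one = Some |` A\<rparr>"

definition pinverse :: "('a \<rightharpoonup> 'a) \<Rightarrow> ('a \<rightharpoonup> 'a)" where
  "pinverse f = (\<lambda>y. if y \<in> ran f then Some (THE x. f x = Some y) else None)"

definition left_trans :: "('a, 'm) monoid_scheme \<Rightarrow> 'a \<Rightarrow> ('a \<rightharpoonup> 'a)" where
  "left_trans S s = (\<lambda>t. Some (s \<otimes>\<^bsub>S\<^esub> t)) |` carrier S"

inductive_set left_hull_set :: "('a, 'm) monoid_scheme \<Rightarrow> ('a \<rightharpoonup> 'a) set"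
  for S :: "('a, 'm) monoid_scheme" where
  generator: "s \<in> carrier S \<Longrightarrow> left_trans S s \<in> left_hull_set S"
| product: "\<lbrakk>f \<in> left_hull_set S; g \<in> left_hull_set S\<rbrakk>
    \<Longrightarrow> f \<otimes>\<^bsub>partial_bij (carrier S)\<^esub> g \<in> left_hull_set S"
| inverse: "f \<in> left_hull_set S \<Longrightarrow> pinverse f \<in> left_hull_set S"

definition left_hull :: "('a, 'm) monoid_scheme \<Rightarrow> ('a \<rightharpoonup> 'a) monoid" where
  "left_hull S = (partial_bij (carrier S))\<lparr>carrier := left_hull_set S\<rparr>"


section \<open>The maximal group image\<close>

definition hull_cong :: "('a, 'm) monoid_scheme \<Rightarrow> (('a \<rightharpoonup> 'a) \<times> ('a \<rightharpoonup> 'a)) set" where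
  "hull_cong S =
     {(p, q). p \<in> carrier (left_hull S) \<and> q \<in> carrier (left_hull S) \<and>
        (\<exists>r \<in> carrier (left_hull S). p \<otimes>\<^bsub>left_hull S\<^esub> r = q \<otimes>\<^bsub>left_hull S\<^esub> r)}"

definition hull_class :: "('a, 'm) monoid_scheme \<Rightarrow> ('a \<rightharpoonup> 'a) \<Rightarrow> ('a \<rightharpoonup> 'a) set" where
  "hull_class S p = hull_cong S `` {p}"

text \<open>The product of two classes is the saturation of their elementwise product; lemma
  \<open>hull_class_mult\<close> below shows that it is the class of the product of any representatives.\<close>

definition hull_group :: "('a, 'm) monoid_scheme \<Rightarrow> ('a \<rightharpoonup> 'a) set monoid" where
  "hull_group S =
     \<lparr>carrier = carrier (left_hull S) // hull_cong S,
      mult = (\<lambda>X Y. hull_cong S `` (X <#>\<^bsub>left_hull S\<^esub> Y)),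
      one = hull_class S \<one>\<^bsub>left_hull S\<^esub>\<rparr>"

definition hull_embed :: "('a, 'm) monoid_scheme \<Rightarrow> 'a \<Rightarrow> ('a \<rightharpoonup> 'a) set" where
  "hull_embed S s = hull_class S (left_trans S s)"


section \<open>Well-definedness\<close>

lemma left_hull_simps [simp]:
  "carrier (left_hull S) = left_hull_set S"
  "mult (left_hull S) = (\<circ>\<^sub>m)"
  "one (left_hull S) = Some |` carrier S"
  by (simp_all add: left_hull_def partial_bij_def)

lemma map_comp_assoc: "(f \<circ>\<^sub>m g) \<circ>\<^sub>m h = f \<circ>\<^sub>m (g \<circ>\<^sub>m h)"
  by (rule ext) (simp add: map_comp_def split: option.splits)

lemma pinverse_Some_iff:
  assumes "inj_on f (dom f)"
  shows "pinverse f y = Some x \<longleftrightarrow> f x = Some y"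
proof -
  have uniq: "x1 = x2" if "f x1 = Some y" "f x2 = Some y" for x1 x2
    using assms that by (auto simp: inj_on_def dom_def)
  have "(THE x. f x = Some y) = x1" if "f x1 = Some y" for x1
    using that uniq by blast
  then show ?thesis
    by (auto simp: pinverse_def ran_def)
qed

context lc_lr_monoid
begin

lemma left_hull_set_partial_bij:
  "f \<in> left_hull_set S \<Longrightarrow> f \<in> carrier (partial_bij (carrier S))"
proof (induction rule: left_hull_set.induct)
  case (generator s)
  have "dom (left_trans S s) = carrier S"
    by (auto simp: left_trans_def dom_def restrict_map_def)
  moreover have "ran (left_trans S s) \<subseteq> carrier S"
    using generator by (auto simp: left_trans_def ran_def restrict_map_def)
  moreover have "inj_on (left_trans S s) (carrier S)"
  proof (rule inj_onI)
    fix r t assume "r \<in> carrier S" "t \<in> carrier S" "left_trans S s r = left_trans S s t"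
    with left_cancel[of s r t] generator show "r = t" by (simp add: left_trans_def)
  qed
  ultimately show ?case
    by (simp add: partial_bij_def)
next
  case (product f g)
  show ?case
  proof -
    have inj: "inj_on f (dom f)" "inj_on g (dom g)"
      and sub: "dom g \<subseteq> carrier S" "ran f \<subseteq> carrier S"
      using product.IH by (auto simp: partial_bij_def)
    have "inj_on (f \<circ>\<^sub>m g) (dom (f \<circ>\<^sub>m g))"
    proof (rule inj_onI)
      fix x y assume "x \<in> dom (f \<circ>\<^sub>m g)" and eq: "(f \<circ>\<^sub>m g) x = (f \<circ>\<^sub>m g) y"
      then obtain z where z: "(f \<circ>\<^sub>m g) x = Some z" by blast
      obtain u where u: "g x = Some u" "f u = Some z"
        using z unfolding map_comp_Some_iff by blast
      obtain v where v: "g y = Some v" "f v = Some z"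
        using z unfolding eq map_comp_Some_iff by blast
      have "u = v" using inj_onD[OF inj(1), of u v] u v by (simp add: domI)
      then show "x = y" using inj_onD[OF inj(2), of x y] u v by (simp add: domI)
    qed
    moreover have "dom (f \<circ>\<^sub>m g) \<subseteq> dom g" "ran (f \<circ>\<^sub>m g) \<subseteq> ran f"
      by (auto simp: dom_def ran_def map_comp_Some_iff)
    ultimately show ?thesis
      using sub by (auto simp: partial_bij_def)
  qed
next
  case (inverse f)
  then have inj: "inj_on f (dom f)" and sub: "dom f \<subseteq> carrier S" "ran f \<subseteq> carrier S"
    by (auto simp: partial_bij_def)
  note iff = pinverse_Some_iff[OF inj]
  have "inj_on (pinverse f) (dom (pinverse f))"
  proof (rule inj_onI)
    fix y z assume "y \<in> dom (pinverse f)" and eq: "pinverse f y = pinverse f z"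
    then obtain x where x: "pinverse f y = Some x" by blast
    then have "pinverse f z = Some x" using eq by simp
    with x have "f x = Some y" "f x = Some z" by (simp_all only: iff)
    then show "y = z" by simp
  qed
  moreover have "dom (pinverse f) \<subseteq> carrier S" "ran (pinverse f) \<subseteq> carrier S"
    using sub by (auto simp: iff dom_def ran_def)
  ultimately show ?case
    by (simp add: partial_bij_def)
qed

lemma left_hull_set_inj: "f \<in> left_hull_set S \<Longrightarrow> inj_on f (dom f)"
  and left_hull_set_dom: "f \<in> left_hull_set S \<Longrightarrow> dom f \<subseteq> carrier S"
  and left_hull_set_ran: "f \<in> left_hull_set S \<Longrightarrow> ran f \<subseteq> carrier S"
  using left_hull_set_partial_bij by (auto simp: partial_bij_def)

lemma left_hull_set_comp: "\<lbrakk>f \<in> left_hull_set S; g \<in> left_hull_set S\<rbrakk> \<Longrightarrow> f \<circ>\<^sub>m g \<in> left_hull_set S"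
  using left_hull_set.product[of f S g] by (simp add: partial_bij_def)

lemma left_trans_one: "left_trans S \<one> = Some |` carrier S"
  by (auto simp: left_trans_def restrict_map_def)

lemma left_hull_set_one: "Some |` carrier S \<in> left_hull_set S"
  using left_hull_set.generator[OF one_closed] by (simp add: left_trans_one)

lemma left_hull_set_one_comp: "f \<in> left_hull_set S \<Longrightarrow> (Some |` carrier S) \<circ>\<^sub>m f = f"
  using left_hull_set_ran[of f]
  by (intro ext) (fastforce simp: map_comp_def restrict_map_def ran_def split: option.splits)

lemma left_hull_set_comp_one: "f \<in> left_hull_set S \<Longrightarrow> f \<circ>\<^sub>m (Some |` carrier S) = f"
  using left_hull_set_dom[of f]
  by (intro ext) (simp add: map_comp_def restrict_map_def, metis domIff subsetD)

lemma left_hull_monoid: "monoid (left_hull S)"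
  by (rule monoidI)
    (simp_all add: left_hull_set_comp left_hull_set_one map_comp_assoc
      left_hull_set_one_comp left_hull_set_comp_one)

lemma comp_pinverse:
  assumes "f \<in> left_hull_set S"
  shows "f \<circ>\<^sub>m pinverse f = Some |` ran f"
proof (rule ext)
  fix y
  note iff = pinverse_Some_iff[OF left_hull_set_inj[OF assms]]
  show "(f \<circ>\<^sub>m pinverse f) y = (Some |` ran f) y"
  proof (cases "y \<in> ran f")
    case True
    then obtain x where "f x = Some y" by (auto simp: ran_def)
    with iff[of y x] True show ?thesis by (simp add: restrict_map_def)
  next
    case False
    then show ?thesis by (simp add: pinverse_def restrict_map_def map_comp_def)
  qed
qed

lemma pinverse_comp:
  assumes "f \<in> left_hull_set S"
  shows "pinverse f \<circ>\<^sub>m f = Some |` dom f"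
proof (rule ext)
  fix x
  note iff = pinverse_Some_iff[OF left_hull_set_inj[OF assms]]
  show "(pinverse f \<circ>\<^sub>m f) x = (Some |` dom f) x"
  proof (cases "f x")
    case None
    then show ?thesis by (auto simp: restrict_map_def map_comp_def)
  next
    case (Some y)
    with iff[of y x] show ?thesis by (auto simp: restrict_map_def)
  qed
qed

lemma hull_cong_iff_idem:
  "(p, q) \<in> hull_cong S \<longleftrightarrow> p \<in> left_hull_set S \<and> q \<in> left_hull_set S \<and>
     (\<exists>A. Some |` A \<in> left_hull_set S \<and> p \<circ>\<^sub>m (Some |` A) = q \<circ>\<^sub>m (Some |` A))"
proof -
  have "\<exists>A. Some |` A \<in> left_hull_set S \<and> p \<circ>\<^sub>m (Some |` A) = q \<circ>\<^sub>m (Some |` A)"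
    if "r \<in> left_hull_set S" "p \<circ>\<^sub>m r = q \<circ>\<^sub>m r" for r
    using that by (metis comp_pinverse left_hull_set.inverse left_hull_set_comp map_comp_assoc)
  then show ?thesis
    by (auto simp: hull_cong_def)
qed

lemma idem_comp: "(Some |` A) \<circ>\<^sub>m (Some |` B) = Some |` (A \<inter> B)"
  by (auto simp: map_comp_def restrict_map_def)

lemma hull_cong_equiv: "equiv (left_hull_set S) (hull_cong S)"
proof (rule equivI)
  show "hull_cong S \<subseteq> left_hull_set S \<times> left_hull_set S"
    by (auto simp: hull_cong_def)
  show "refl_on (left_hull_set S) (hull_cong S)"
    by (auto simp: refl_on_def hull_cong_def)
  show "sym (hull_cong S)"
    by (auto simp: sym_def hull_cong_def) metis
  show "trans (hull_cong S)"
  proof (rule transI)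
    fix p q r assume "(p, q) \<in> hull_cong S" "(q, r) \<in> hull_cong S"
    then obtain A B where
      h: "p \<in> left_hull_set S" "r \<in> left_hull_set S"
        "Some |` A \<in> left_hull_set S" "Some |` B \<in> left_hull_set S"
      and A: "p \<circ>\<^sub>m (Some |` A) = q \<circ>\<^sub>m (Some |` A)"
      and B: "q \<circ>\<^sub>m (Some |` B) = r \<circ>\<^sub>m (Some |` B)"
      unfolding hull_cong_iff_idem by auto
    have "p \<circ>\<^sub>m (Some |` (A \<inter> B)) = q \<circ>\<^sub>m (Some |` (B \<inter> A))"
      using A by (metis idem_comp map_comp_assoc inf_commute)
    also have "\<dots> = r \<circ>\<^sub>m (Some |` (A \<inter> B))"
      using B by (metis idem_comp map_comp_assoc inf_commute)
    finally show "(p, r) \<in> hull_cong S"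
      unfolding hull_cong_iff_idem using h left_hull_set_comp idem_comp by metis
  qed
qed

lemma hull_cong_comp:
  assumes "(p, q) \<in> hull_cong S" "(r, t) \<in> hull_cong S"
  shows "(p \<circ>\<^sub>m r, q \<circ>\<^sub>m t) \<in> hull_cong S"
proof -
  obtain A where h: "p \<in> left_hull_set S" "q \<in> left_hull_set S" "Some |` A \<in> left_hull_set S"
    and A: "p \<circ>\<^sub>m (Some |` A) = q \<circ>\<^sub>m (Some |` A)"
    using assms(1) unfolding hull_cong_iff_idem by auto
  have r: "r \<in> left_hull_set S" and t: "t \<in> left_hull_set S"
    using assms(2) by (auto simp: hull_cong_def)
  let ?e = "pinverse r \<circ>\<^sub>m ((Some |` A) \<circ>\<^sub>m r)"
  have e: "?e \<in> left_hull_set S"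
    using h r by (intro left_hull_set_comp left_hull_set.inverse)
  have "r \<circ>\<^sub>m ?e = (Some |` ran r) \<circ>\<^sub>m ((Some |` A) \<circ>\<^sub>m r)"
    by (simp add: comp_pinverse[OF r] map_comp_assoc[symmetric])
  also have "\<dots> = (Some |` A) \<circ>\<^sub>m ((Some |` ran r) \<circ>\<^sub>m r)"
    by (metis idem_comp map_comp_assoc inf_commute)
  finally have re: "r \<circ>\<^sub>m ?e = (Some |` A) \<circ>\<^sub>m ((Some |` ran r) \<circ>\<^sub>m r)" .
  have "(p \<circ>\<^sub>m r) \<circ>\<^sub>m ?e = (q \<circ>\<^sub>m r) \<circ>\<^sub>m ?e"
    unfolding map_comp_assoc re[unfolded map_comp_assoc] using A by (metis map_comp_assoc)
  with e h r have 1: "(p \<circ>\<^sub>m r, q \<circ>\<^sub>m r) \<in> hull_cong S"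
    by (auto simp: hull_cong_def left_hull_set_comp)
  have 2: "(q \<circ>\<^sub>m r, q \<circ>\<^sub>m t) \<in> hull_cong S"
  proof -
    obtain u where "u \<in> left_hull_set S" "r \<circ>\<^sub>m u = t \<circ>\<^sub>m u"
      using assms(2) by (auto simp: hull_cong_def)
    then have "\<exists>u \<in> left_hull_set S. q \<circ>\<^sub>m r \<circ>\<^sub>m u = q \<circ>\<^sub>m t \<circ>\<^sub>m u"
      unfolding map_comp_assoc by metis
    then show ?thesis
      using h r t by (simp add: hull_cong_def left_hull_set_comp)
  qed
  show ?thesis
    using 1 2 hull_cong_equiv by (meson equivE transD)
qed

lemma hull_class_eq_iff:
  "\<lbrakk>p \<in> left_hull_set S; q \<in> left_hull_set S\<rbrakk>
    \<Longrightarrow> hull_class S p = hull_class S q \<longleftrightarrow> (p, q) \<in> hull_cong S"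
  unfolding hull_class_def using hull_cong_equiv by (simp add: eq_equiv_class_iff)

lemma hull_class_mult:
  assumes "p \<in> left_hull_set S" "q \<in> left_hull_set S"
  shows "hull_class S p \<otimes>\<^bsub>hull_group S\<^esub> hull_class S q = hull_class S (p \<circ>\<^sub>m q)"
proof -
  have refl: "(p, p) \<in> hull_cong S" "(q, q) \<in> hull_cong S"
    using assms by (auto simp: hull_cong_def)
  have "hull_cong S `` (hull_class S p <#>\<^bsub>left_hull S\<^esub> hull_class S q) = hull_class S (p \<circ>\<^sub>m q)"
  proof (intro equalityI subsetI)
    fix x assume "x \<in> hull_cong S `` (hull_class S p <#>\<^bsub>left_hull S\<^esub> hull_class S q)"
    then obtain p' q' where
      "(p, p') \<in> hull_cong S" "(q, q') \<in> hull_cong S" "(p' \<circ>\<^sub>m q', x) \<in> hull_cong S"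
      by (auto simp: set_mult_def hull_class_def)
    then show "x \<in> hull_class S (p \<circ>\<^sub>m q)"
      using hull_cong_comp hull_cong_equiv unfolding hull_class_def
      by (meson Image_singleton_iff equivE transD)
  next
    fix x assume "x \<in> hull_class S (p \<circ>\<^sub>m q)"
    then show "x \<in> hull_cong S `` (hull_class S p <#>\<^bsub>left_hull S\<^esub> hull_class S q)"
      using refl by (auto simp: set_mult_def hull_class_def)
  qed
  then show ?thesis by (simp add: hull_group_def)
qed

lemma hull_group_carrier: "carrier (hull_group S) = hull_class S ` left_hull_set S"
  by (auto simp: hull_group_def quotient_def hull_class_def)

lemma hull_class_pinverse:
  assumes "p \<in> left_hull_set S"
  shows "hull_class S (pinverse p \<circ>\<^sub>m p) = \<one>\<^bsub>hull_group S\<^esub>"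
proof -
  let ?e = "Some |` dom p"
  have e: "?e \<in> left_hull_set S"
    using assms pinverse_comp by (metis left_hull_set.inverse left_hull_set_comp)
  have "?e \<circ>\<^sub>m ?e = (Some |` carrier S) \<circ>\<^sub>m ?e"
    by (simp only: left_hull_set_one_comp[OF e]) (simp only: idem_comp Int_absorb)
  with e have "(?e, Some |` carrier S) \<in> hull_cong S"
    using left_hull_set_one by (auto simp: hull_cong_def)
  then show ?thesis
    using assms e left_hull_set_one by (simp add: pinverse_comp hull_class_eq_iff hull_group_def)
qed

lemma hull_group_group: "group (hull_group S)"
proof (rule groupI)
  show "x \<otimes>\<^bsub>hull_group S\<^esub> y \<in> carrier (hull_group S)"
    if "x \<in> carrier (hull_group S)" "y \<in> carrier (hull_group S)" for x y
    using that by (auto simp: hull_group_carrier hull_class_mult left_hull_set_comp)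
  show "\<one>\<^bsub>hull_group S\<^esub> \<in> carrier (hull_group S)"
    unfolding hull_group_carrier using left_hull_set_one by (simp add: hull_group_def)
  show "x \<otimes>\<^bsub>hull_group S\<^esub> y \<otimes>\<^bsub>hull_group S\<^esub> z = x \<otimes>\<^bsub>hull_group S\<^esub> (y \<otimes>\<^bsub>hull_group S\<^esub> z)"
    if "x \<in> carrier (hull_group S)" "y \<in> carrier (hull_group S)" "z \<in> carrier (hull_group S)"
    for x y z
    using that
    by (auto simp: hull_group_carrier hull_class_mult left_hull_set_comp map_comp_assoc)
  show "\<one>\<^bsub>hull_group S\<^esub> \<otimes>\<^bsub>hull_group S\<^esub> x = x" if "x \<in> carrier (hull_group S)" for x
  proof -
    have "\<one>\<^bsub>hull_group S\<^esub> = hull_class S (Some |` carrier S)"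
      by (simp add: hull_group_def)
    then show ?thesis
      using that left_hull_set_one
      by (auto simp: hull_group_carrier hull_class_mult left_hull_set_one_comp)
  qed
  show "\<exists>y \<in> carrier (hull_group S). y \<otimes>\<^bsub>hull_group S\<^esub> x = \<one>\<^bsub>hull_group S\<^esub>"
    if x: "x \<in> carrier (hull_group S)" for x
  proof -
    obtain p where p: "p \<in> left_hull_set S" "x = hull_class S p"
      using x by (auto simp: hull_group_carrier)
    then have "hull_class S (pinverse p) \<otimes>\<^bsub>hull_group S\<^esub> x = \<one>\<^bsub>hull_group S\<^esub>"
      by (simp add: hull_class_mult hull_class_pinverse left_hull_set.inverse)
    then show ?thesis
      using p by (auto simp: hull_group_carrier left_hull_set.inverse)
  qed
qed

end

end

theory Submission
  imports Defs
begin

text \<open>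
  Every element \<open>f\<close> of the left inverse hull commutes with right translations and, by left
  reversibility, has nonempty domain. A homomorphism \<open>\<phi>\<close> into a group turns \<open>f\<close> into a left
  translation: there is a unique group element \<open>h\<close> with \<open>\<phi> (f x) = h \<phi> x\<close> on the domain of \<open>f\<close>.
  If \<open>p r = q r\<close>, comparing both sides at one point of the domain shows that \<open>p\<close> and \<open>q\<close> have the
  same \<open>h\<close>, so \<open>f \<mapsto> h\<close> descends to the maximal group image. The functorial statement is the
  universal property applied to \<open>\<gamma>\<^sub>R \<circ> \<phi>\<close>.
\<close>

context lc_lr_monoid
begin

lemma left_trans_Some_iff: "left_trans S s x = Some y \<longleftrightarrow> x \<in> carrier S \<and> y = s \<otimes> x"
  by (auto simp: left_trans_def restrict_map_def)

lemma left_hull_set_SomeD: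
  assumes "f \<in> left_hull_set S" "f x = Some y"
  shows "x \<in> carrier S" "y \<in> carrier S"
  using left_hull_set_dom[OF assms(1)] left_hull_set_ran[OF assms(1)] assms(2)
  by (auto intro: ranI)

lemma left_hull_set_pinverse_Some_iff:
  "f \<in> left_hull_set S \<Longrightarrow> pinverse f y = Some x \<longleftrightarrow> f x = Some y"
  by (rule pinverse_Some_iff[OF left_hull_set_inj])

text \<open>Associativity makes left translations commute with right translations, and this passes
  to composites. For \<open>pinverse\<close> the graph is read backwards, so the induction must keep
  \<open>x\<close> and \<open>y\<close> arbitrary.\<close>

lemma left_hull_set_right_mult:
  assumes "f \<in> left_hull_set S" "f x = Some y" "t \<in> carrier S"
  shows "f (x \<otimes> t) = Some (y \<otimes> t)"
  using assms
proof (induction arbitrary: x y rule: left_hull_set.induct)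
  case (generator s)
  then show ?case by (simp add: left_trans_Some_iff m_assoc)
next
  case (product f g)
  then show ?case by (auto simp: partial_bij_def map_comp_Some_iff)
next
  case (inverse f)
  then show ?case by (simp add: left_hull_set_pinverse_Some_iff)
qed

text \<open>This is where left reversibility enters, to handle composites. Were the empty map in the
  hull, composing with it would make all elements congruent.\<close>

lemma left_hull_set_nonempty:
  assumes "f \<in> left_hull_set S"
  shows "\<exists>x y. f x = Some y"
  using assms
proof (induction rule: left_hull_set.induct)
  case (generator s)
  then show ?case by (auto simp: left_trans_Some_iff)
next
  case (product f g)
  then obtain x y u v where f: "f x = Some y" and g: "g u = Some v" by blast
  have "x \<in> carrier S" "v \<in> carrier S"
    using product f g left_hull_set_SomeD by blast+
  \<comment> \<open>The domain of \<open>f\<close> and the range of \<open>g\<close> are closed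
    under right multiplication, so \<open>x\<close> and \<open>v\<close> can be moved to a common
    point, at which \<open>f\<close> can be applied after \<open>g\<close>.\<close>
  then obtain a b where ab: "a \<in> carrier S" "b \<in> carrier S" "x \<otimes> a = v \<otimes> b"
    using left_reversible[of x v] by (fastforce simp: l_coset_def)
  have "f (v \<otimes> b) = Some (y \<otimes> a)" "g (u \<otimes> b) = Some (v \<otimes> b)"
    using left_hull_set_right_mult[OF product.hyps(1) f ab(1)]
      left_hull_set_right_mult[OF product.hyps(2) g ab(2)] ab(3) by simp_all
  then show ?case by (auto simp: partial_bij_def map_comp_Some_iff)
next
  case (inverse f)
  then show ?case by (auto simp: left_hull_set_pinverse_Some_iff)
qed

lemma left_trans_mult:
  assumes "s \<in> carrier S" "t \<in> carrier S"
  shows "left_trans S (s \<otimes> t) = left_trans S s \<circ>\<^sub>m left_trans S t"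
  using assms by (auto simp: left_trans_def map_comp_def restrict_map_def m_assoc)

lemma hull_embed_hom: "hull_embed S \<in> monoid_hom S (hull_group S)"
proof -
  have "hull_embed S \<one> = \<one>\<^bsub>hull_group S\<^esub>"
    by (simp add: hull_embed_def left_trans_one hull_group_def)
  moreover have "hull_embed S \<in> hom S (hull_group S)"
    by (rule homI) (auto simp: hull_embed_def hull_group_carrier left_hull_set.generator
        hull_class_mult left_trans_mult)
  ultimately show ?thesis by (simp add: monoid_hom_def)
qed

text \<open>In a group a left inverse is the inverse. This turns the \<open>pinverse\<close> case of
  an induction over the hull into inversion in the group, which homomorphisms respect.\<close>

lemma hull_class_pinverse_inv:
  assumes "f \<in> left_hull_set S"
  shows "hull_class S (pinverse f) = inv\<^bsub>hull_group S\<^esub> hull_class S f"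
proof -
  interpret G: group "hull_group S" by (rule hull_group_group)
  have "hull_class S (pinverse f) \<otimes>\<^bsub>hull_group S\<^esub> hull_class S f = \<one>\<^bsub>hull_group S\<^esub>"
    using assms by (simp add: hull_class_mult hull_class_pinverse left_hull_set.inverse)
  then show ?thesis
    using assms by (intro G.inv_equality[symmetric])
      (auto simp: hull_group_carrier left_hull_set.inverse)
qed

text \<open>Uniqueness half of the universal property: left translations generate the hull under
  composition and inversion, so their classes generate the group, and a homomorphism is determined
  by its values on generators.\<close>

lemma hull_group_hom_eqI:
  assumes "group H" "\<psi> \<in> hom (hull_group S) H" "\<psi>' \<in> hom (hull_group S) H"
    and eq: "\<And>s. s \<in> carrier S \<Longrightarrow> \<psi> (hull_embed S s) = \<psi>' (hull_embed S s)"
    and X: "X \<in> carrier (hull_group S)"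
  shows "\<psi> X = \<psi>' X"
proof -
  interpret f: group_hom "hull_group S" H \<psi>
    using assms hull_group_group by (simp add: group_hom_def group_hom_axioms_def)
  interpret g: group_hom "hull_group S" H \<psi>'
    using assms hull_group_group by (simp add: group_hom_def group_hom_axioms_def)
  have "\<psi> (hull_class S p) = \<psi>' (hull_class S p)" if "p \<in> left_hull_set S" for p
    using that
  proof (induction rule: left_hull_set.induct)
    case (generator s)
    then show ?case using eq by (simp add: hull_embed_def)
  next
    case (product p q)
    then have "hull_class S p \<in> carrier (hull_group S)" "hull_class S q \<in> carrier (hull_group S)"
      by (simp_all add: hull_group_carrier)
    with product show ?case
      by (simp add: partial_bij_def hull_class_mult[symmetric])
  next
    case (inverse p)
    then have "hull_class S p \<in> carrier (hull_group S)"
      by (simp add: hull_group_carrier)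
    with inverse show ?case by (simp add: hull_class_pinverse_inv)
  qed
  then show ?thesis using X by (auto simp: hull_group_carrier)
qed

end

text \<open>A relation rather than a function, because the empty map would be related to every
  \<open>h\<close>. Existence of \<open>h\<close> comes from induction over the hull, uniqueness
  from nonempty domains.\<close>

definition translation_by ::
    "('b, 'n) monoid_scheme \<Rightarrow> ('a \<Rightarrow> 'b) \<Rightarrow> ('a \<rightharpoonup> 'a) \<Rightarrow> 'b \<Rightarrow> bool" where
  "translation_by H \<phi> f h \<longleftrightarrow>
     h \<in> carrier H \<and> (\<forall>x y. f x = Some y \<longrightarrow> \<phi> y = h \<otimes>\<^bsub>H\<^esub> \<phi> x)"

locale lc_lr_monoid_to_group = lc_lr_monoid S + H: group H
  for S (structure) and H :: "('b, 'n) monoid_scheme" and \<phi> +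
  assumes hom: "\<phi> \<in> monoid_hom S H"
begin

lemma phi_closed [simp]: "x \<in> carrier S \<Longrightarrow> \<phi> x \<in> carrier H"
  using hom by (auto simp: monoid_hom_def hom_def)

lemma phi_mult [simp]:
  "\<lbrakk>x \<in> carrier S; y \<in> carrier S\<rbrakk> \<Longrightarrow> \<phi> (x \<otimes> y) = \<phi> x \<otimes>\<^bsub>H\<^esub> \<phi> y"
  using hom by (auto simp: monoid_hom_def hom_def)

lemma translation_by_left_trans: "s \<in> carrier S \<Longrightarrow> translation_by H \<phi> (left_trans S s) (\<phi> s)"
  by (auto simp: translation_by_def left_trans_Some_iff)

lemma translation_by_comp:
  assumes "f \<in> left_hull_set S" "g \<in> left_hull_set S"
    and "translation_by H \<phi> f h" "translation_by H \<phi> g k"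
  shows "translation_by H \<phi> (f \<circ>\<^sub>m g) (h \<otimes>\<^bsub>H\<^esub> k)"
proof -
  have "\<phi> z = h \<otimes>\<^bsub>H\<^esub> k \<otimes>\<^bsub>H\<^esub> \<phi> x" if "g x = Some y" "f y = Some z" for x y z
    using that assms left_hull_set_SomeD[OF assms(2)]
    by (simp add: translation_by_def H.m_assoc)
  then show ?thesis
    using assms by (auto simp: translation_by_def map_comp_Some_iff)
qed

lemma translation_by_pinverse:
  assumes "f \<in> left_hull_set S" "translation_by H \<phi> f h"
  shows "translation_by H \<phi> (pinverse f) (inv\<^bsub>H\<^esub> h)"
proof -
  have h: "h \<in> carrier H" and eq: "f x = Some y \<Longrightarrow> \<phi> y = h \<otimes>\<^bsub>H\<^esub> \<phi> x" for x y
    using assms(2) unfolding translation_by_def by blast+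
  have "\<phi> x = inv\<^bsub>H\<^esub> h \<otimes>\<^bsub>H\<^esub> \<phi> y" if "f x = Some y" for x y
    using left_hull_set_SomeD[OF assms(1) that]
    by (subst eq[OF that]) (simp add: h H.m_assoc[symmetric])
  then show ?thesis
    using h unfolding translation_by_def left_hull_set_pinverse_Some_iff[OF assms(1)] by blast
qed

lemma translation_by_exists:
  assumes "f \<in> left_hull_set S"
  shows "\<exists>h. translation_by H \<phi> f h"
  using assms
proof (induction rule: left_hull_set.induct)
  case (generator s)
  then show ?case using translation_by_left_trans by blast
next
  case (product f g)
  then show ?case using translation_by_comp by (fastforce simp: partial_bij_def)
next
  case (inverse f)
  then show ?case using translation_by_pinverse by blast
qed

text \<open>Since \<open>p r = q r\<close> is defined somewhere, \<open>p\<close> and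
  \<open>q\<close> agree at some point \<open>y\<close>; cancelling \<open>\<phi> y\<close> in the
  group gives the claim. Allowing congruent \<open>p\<close> and \<open>q\<close> covers both
  uniqueness of \<open>h\<close> for one map and independence of the representative.\<close>

lemma translation_by_unique:
  assumes "(p, q) \<in> hull_cong S" "translation_by H \<phi> p h" "translation_by H \<phi> q k"
  shows "h = k"
proof -
  obtain r where r: "p \<in> left_hull_set S" "r \<in> left_hull_set S" "p \<circ>\<^sub>m r = q \<circ>\<^sub>m r"
    using assms(1) by (auto simp: hull_cong_def)
  then obtain x z where z: "(p \<circ>\<^sub>m r) x = Some z"
    using left_hull_set_nonempty[OF left_hull_set_comp] by blast
  then obtain y where y: "r x = Some y" "p y = Some z"
    by (auto simp: map_comp_Some_iff)
  have "q y = Some z"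
    using z y unfolding r(3) by (simp add: map_comp_def)
  then have "h \<otimes>\<^bsub>H\<^esub> \<phi> y = k \<otimes>\<^bsub>H\<^esub> \<phi> y"
    using assms(2,3) y unfolding translation_by_def by metis
  moreover have "y \<in> carrier S"
    using left_hull_set_SomeD[OF r(1) y(2)] by simp
  ultimately show ?thesis
    using assms(2,3) by (simp add: translation_by_def)
qed

text \<open>Restricted to the carrier so that the lift is extensional and can be unique as a total
  function.\<close>

definition hull_lift :: "('a \<rightharpoonup> 'a) set \<Rightarrow> 'b" where
  "hull_lift = (\<lambda>X \<in> carrier (hull_group S). THE h. \<exists>p \<in> X. translation_by H \<phi> p h)"

text \<open>Evaluates the definite description through any chosen representative: \<open>p\<close>
  lies in its own class, and every congruent map has the same translating element.\<close>

lemma hull_lift_eqI: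
  assumes "p \<in> left_hull_set S" "translation_by H \<phi> p h"
  shows "hull_lift (hull_class S p) = h"
proof -
  have "(p, p) \<in> hull_cong S"
    using assms(1) by (auto simp: hull_cong_def)
  then have "(THE k. \<exists>q \<in> hull_class S p. translation_by H \<phi> q k) = h"
    using assms(2) translation_by_unique
    by (intro the_equality) (auto simp: hull_class_def)
  then show ?thesis
    using assms(1) by (simp add: hull_lift_def hull_group_carrier)
qed

lemma hull_lift_embed: "s \<in> carrier S \<Longrightarrow> hull_lift (hull_embed S s) = \<phi> s"
  unfolding hull_embed_def
  by (intro hull_lift_eqI left_hull_set.generator translation_by_left_trans)

lemma hull_lift_hom: "hull_lift \<in> hom (hull_group S) H"
proof (rule homI)
  fix X assume "X \<in> carrier (hull_group S)"
  then obtain p where p: "p \<in> left_hull_set S" "X = hull_class S p"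
    by (auto simp: hull_group_carrier)
  obtain h where h: "translation_by H \<phi> p h"
    using translation_by_exists[OF p(1)] by blast
  then show "hull_lift X \<in> carrier H"
    using hull_lift_eqI[OF p(1) h] p by (simp add: translation_by_def)
next
  fix X Y assume "X \<in> carrier (hull_group S)" "Y \<in> carrier (hull_group S)"
  then obtain p q where p: "p \<in> left_hull_set S" "X = hull_class S p"
    and q: "q \<in> left_hull_set S" "Y = hull_class S q"
    by (auto simp: hull_group_carrier)
  obtain h k where "translation_by H \<phi> p h" "translation_by H \<phi> q k"
    using translation_by_exists p q by blast
  then show "hull_lift (X \<otimes>\<^bsub>hull_group S\<^esub> Y) = hull_lift X \<otimes>\<^bsub>H\<^esub> hull_lift Y"
    using p q by (simp add: hull_class_mult hull_lift_eqI left_hull_set_comp translation_by_comp)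
qed

theorem hull_group_universal:
  "\<exists>!\<phi>'. \<phi>' \<in> monoid_hom (hull_group S) H \<and> \<phi>' \<in> extensional (carrier (hull_group S)) \<and>
     (\<forall>s \<in> carrier S. \<phi>' (hull_embed S s) = \<phi> s)"
proof (rule ex1I)
  \<comment> \<open>\<open>monoid_hom\<close> also asks for preservation of the identity, which is
    automatic for a multiplicative map between groups.\<close>
  have "hull_lift \<one>\<^bsub>hull_group S\<^esub> = \<one>\<^bsub>H\<^esub>"
    using hom_one[OF hull_lift_hom hull_group_group H.group_axioms] .
  then show "hull_lift \<in> monoid_hom (hull_group S) H \<and>
      hull_lift \<in> extensional (carrier (hull_group S)) \<and>
      (\<forall>s \<in> carrier S. hull_lift (hull_embed S s) = \<phi> s)"
    using hull_lift_hom by (simp add: monoid_hom_def hull_lift_embed) (simp add: hull_lift_def)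
next
  fix \<psi>
  assume \<psi>: "\<psi> \<in> monoid_hom (hull_group S) H \<and> \<psi> \<in> extensional (carrier (hull_group S)) \<and>
    (\<forall>s \<in> carrier S. \<psi> (hull_embed S s) = \<phi> s)"
  show "\<psi> = hull_lift"
  proof (rule extensionalityI)
    show "hull_lift \<in> extensional (carrier (hull_group S))"
      by (simp add: hull_lift_def)
    show "\<psi> X = hull_lift X" if "X \<in> carrier (hull_group S)" for X
      by (rule hull_group_hom_eqI[OF H.group_axioms _ hull_lift_hom])
        (use \<psi> that in \<open>auto simp: monoid_hom_def hull_lift_embed\<close>)
  qed (use \<psi> in simp)
qed

end

lemma monoid_hom_comp:
  "\<lbrakk>f \<in> monoid_hom A B; g \<in> monoid_hom B C\<rbrakk> \<Longrightarrow> (\<lambda>x. g (f x)) \<in> monoid_hom A C"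
  by (auto simp: monoid_hom_def hom_def Pi_iff)

theorem theorem3p4p10:
  fixes S :: "('a, 'm) monoid_scheme"
    and H :: "('b, 'n) monoid_scheme"
    and R :: "('c, 'k) monoid_scheme"
  assumes "lc_lr_monoid S"
  shows "(group H \<longrightarrow>
           (\<forall>\<phi> \<in> monoid_hom S H.
             \<exists>!\<phi>'. \<phi>' \<in> monoid_hom (hull_group S) H \<and> \<phi>' \<in> extensional (carrier (hull_group S)) \<and>
               (\<forall>s \<in> carrier S. \<phi>' (hull_embed S s) = \<phi> s))) \<and>
         (lc_lr_monoid R \<longrightarrow>
           (\<forall>\<phi> \<in> monoid_hom S R.
             \<exists>!\<phi>'. \<phi>' \<in> monoid_hom (hull_group S) (hull_group R) \<and>
               \<phi>' \<in> extensional (carrier (hull_group S)) \<and>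
               (\<forall>s \<in> carrier S. \<phi>' (hull_embed S s) = hull_embed R (\<phi> s))))"
proof (intro conjI impI ballI)
  fix \<phi> assume "group H" "\<phi> \<in> monoid_hom S H"
  then interpret lc_lr_monoid_to_group S H \<phi>
    using assms by (simp add: lc_lr_monoid_to_group_def lc_lr_monoid_to_group_axioms_def)
  show "\<exists>!\<phi>'. \<phi>' \<in> monoid_hom (hull_group S) H \<and> \<phi>' \<in> extensional (carrier (hull_group S)) \<and>
      (\<forall>s \<in> carrier S. \<phi>' (hull_embed S s) = \<phi> s)"
    by (rule hull_group_universal)
next
  fix \<phi> assume R: "lc_lr_monoid R" and \<phi>: "\<phi> \<in> monoid_hom S R"
  \<comment> \<open>The target is itself a maximal group image, and the composite is a monoid
    homomorphism because \<open>hull_embed R\<close> is one.\<close>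
  interpret lc_lr_monoid_to_group S "hull_group R" "\<lambda>s. hull_embed R (\<phi> s)"
    using assms lc_lr_monoid.hull_group_group[OF R]
      monoid_hom_comp[OF \<phi> lc_lr_monoid.hull_embed_hom[OF R]]
    by (simp add: lc_lr_monoid_to_group_def lc_lr_monoid_to_group_axioms_def)
  show "\<exists>!\<phi>'. \<phi>' \<in> monoid_hom (hull_group S) (hull_group R) \<and>
      \<phi>' \<in> extensional (carrier (hull_group S)) \<and>
      (\<forall>s \<in> carrier S. \<phi>' (hull_embed S s) = hull_embed R (\<phi> s))"
    by (rule hull_group_universal)
qed

end
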